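(* Let $K$ be a field of characteristic $0$ and $n\geq 1$. For an automorphism $\varphi$ of the polynomial algebra $L_n=K[l_1,\ldots,l_n]$ with $\varphi(l_i)=f_i$ for $1\leq i\leq n$, let $\varphi^*$ be given on the generators of $U_n$ by $$\varphi^*(l_i)=f_i,\qquad \varphi^*(r_i)=\sum_{s=1}^n\frac{\partial f_i}{\partial l_s}\,r_s,\qquad 1\leq i\leq n.$$ Then $\varphi^*$ (extended multiplicatively) is a well-defined automorphism of $U_n$, and the map $\Phi:\mathrm{Aut}(L_n)\to\mathrm{Aut}(U_n)$, $\Phi(\varphi)=\varphi^*$, is an embedding of groups (an injective group homomorphism).
   Context: $U_n$ is the associative unital $K$-algebra generated by $l_1,\ldots,l_n,r_1,\ldots,r_n$ with defining relations $l_il_j=l_jl_i$ and $r_il_j=l_jr_i+r_ir_j$ for all $1\leq i,j\leq n$. The subalgebra generated by $l_1,\ldots,l_n$ is the polynomial algebra $L_n=K[l_1,\ldots,l_n]$. Automorphisms are unital $K$-algebra automorphisms, and the group operation is composition of maps. *)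

theory Defs
  imports Complex_Main "HOL-Library.Poly_Mapping" "HOL-Algebra.Group"
begin

lemma poly_mapping_sum_single: "p = (\<Sum>k\<in>Poly_Mapping.keys p. Poly_Mapping.single k (Poly_Mapping.lookup p k))"
proof (rule poly_mapping_eqI)
  fix j
  have "(\<Sum>k\<in>Poly_Mapping.keys p. Poly_Mapping.lookup (Poly_Mapping.single k (Poly_Mapping.lookup p k)) j) =
        (\<Sum>k\<in>Poly_Mapping.keys p. if k = j then Poly_Mapping.lookup p j else 0)"
    by (rule sum.cong) (auto simp: lookup_single when_def)
  also have "\<dots> = Poly_Mapping.lookup p j"
    by (auto simp: in_keys_iff)
  finally show "Poly_Mapping.lookup p j = Poly_Mapping.lookup (\<Sum>k\<in>Poly_Mapping.keys p. Poly_Mapping.single k (Poly_Mapping.lookup p k)) j"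
    by (simp add: lookup_sum)
qed

lemma poly_mapping_single_induct [case_names zero single add]:
  assumes "P 0" "\<And>k c. P (Poly_Mapping.single k c)" "\<And>p q. P p \<Longrightarrow> P q \<Longrightarrow> P (p + q)"
  shows "P (p :: 'a \<Rightarrow>\<^sub>0 'b::comm_monoid_add)"
proof -
  have "P (\<Sum>k\<in>A. Poly_Mapping.single k (Poly_Mapping.lookup p k))" if "finite A" for A
    using that by induction (use assms in auto)
  then have "P (\<Sum>k\<in>Poly_Mapping.keys p. Poly_Mapping.single k (Poly_Mapping.lookup p k))"
    by simp
  then show ?thesis
    by (simp flip: poly_mapping_sum_single)
qed

definition pm_ext :: "('k \<Rightarrow> 'c \<Rightarrow> 'a) \<Rightarrow> ('k \<Rightarrow>\<^sub>0 'c::comm_monoid_add) \<Rightarrow> 'a::comm_monoid_add"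
  where "pm_ext g p = (\<Sum>k\<in>Poly_Mapping.keys p. g k (Poly_Mapping.lookup p k))"

lemma pm_ext_add:
  assumes "\<And>k. g k 0 = 0" "\<And>k c d. g k (c + d) = g k c + g k d"
  shows "pm_ext g (p + q) = pm_ext g p + pm_ext g q"
  unfolding pm_ext_def using assms by (rule setsum_keys_plus_distrib)

lemma pm_ext_single:
  assumes "\<And>k. g k 0 = 0"
  shows "pm_ext g (Poly_Mapping.single k c) = g k c"
  using assms by (cases "c = 0") (auto simp: pm_ext_def)

lemma pm_ext_mult:
  fixes g :: "'k::monoid_add \<Rightarrow> 'c::semiring_0 \<Rightarrow> 'a::semiring_0"
  assumes g0: "\<And>k. g k 0 = 0" and ga: "\<And>k c d. g k (c + d) = g k c + g k d"
    and gm: "\<And>k l c d. g (k + l) (c * d) = g k c * g l d"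
  shows "pm_ext g (p * q) = pm_ext g p * pm_ext g q"
proof (induction p rule: poly_mapping_single_induct)
  case zero
  then show ?case by (simp add: pm_ext_def)
next
  case (add p p')
  then show ?case by (simp add: pm_ext_add[where g = g, OF g0 ga] distrib_right)
next
  case (single k c)
  show ?case
  proof (induction q rule: poly_mapping_single_induct)
    case zero
    then show ?case by (simp add: pm_ext_def)
  next
    case (single l d)
    then show ?case by (simp add: mult_single gm pm_ext_single[where g = g, OF g0])
  next
    case (add q q')
    then show ?case by (simp add: pm_ext_add[where g = g, OF g0 ga] distrib_left)
  qed
qed

definition alg_hom ::
    "('k::field \<Rightarrow> 'a::ring_1 \<Rightarrow> 'a) \<Rightarrow> ('k \<Rightarrow> 'b::ring_1 \<Rightarrow> 'b) \<Rightarrow> ('a \<Rightarrow> 'b) \<Rightarrow> bool"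
  where "alg_hom sA sB f \<longleftrightarrow>
    Vector_Spaces.linear sA sB f \<and> f 1 = 1 \<and> (\<forall>x y. f (x * y) = f x * f y)"

definition alg_Aut :: "('k::field \<Rightarrow> 'a::ring_1 \<Rightarrow> 'a) \<Rightarrow> ('a \<Rightarrow> 'a) monoid"
  where "alg_Aut s = \<lparr>carrier = {f. alg_hom s s f \<and> bij f}, mult = (\<circ>), one = id\<rparr>"

text \<open>Polynomials are finitely supported maps from exponent vectors to coefficients.\<close>

type_synonym ('k, 'n) mpol = "('n \<Rightarrow>\<^sub>0 nat) \<Rightarrow>\<^sub>0 'k"

definition scaleP :: "'k::field \<Rightarrow> ('k, 'n) mpol \<Rightarrow> ('k, 'n) mpol"
  where "scaleP c p = Poly_Mapping.single 0 c * p"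

definition var :: "'n \<Rightarrow> ('k::field, 'n) mpol"
  where "var i = Poly_Mapping.single (Poly_Mapping.single i 1) 1"

definition pderivative :: "'n \<Rightarrow> ('k::field, 'n) mpol \<Rightarrow> ('k, 'n) mpol"
  where "pderivative s p =
    (\<Sum>m\<in>Poly_Mapping.keys p. Poly_Mapping.single (m - Poly_Mapping.single s 1)
                     (of_nat (Poly_Mapping.lookup m s) * Poly_Mapping.lookup p m))"

lemma vector_space_scaleP: "vector_space scaleP"
  by unfold_locales
    (simp_all add: scaleP_def distrib_left distrib_right single_add mult_single flip: mult.assoc)

datatype 'n gen = GenL 'n | GenR 'n

datatype 'g word = Word (letters: "'g list")

instantiation word :: (type) monoid_add
begin

definition "0 = Word []"
definition "v + w = Word (letters v @ letters w)"

instance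
  by standard (simp_all add: zero_word_def plus_word_def)

end

lemma letters_zero [simp]: "letters 0 = []"
  by (simp add: zero_word_def)

lemma letters_plus [simp]: "letters (v + w) = letters v @ letters w"
  by (simp add: plus_word_def)

text \<open>The multiplication on finitely supported functions is convolution, so the
  following type is the monoid algebra of the free monoid, i.e. the free algebra.\<close>

type_synonym ('k, 'n) free_alg = "'n gen word \<Rightarrow>\<^sub>0 'k"

definition freeL :: "'n \<Rightarrow> ('k::field, 'n) free_alg"
  where "freeL i = Poly_Mapping.single (Word [GenL i]) 1"

definition freeR :: "'n \<Rightarrow> ('k::field, 'n) free_alg"
  where "freeR i = Poly_Mapping.single (Word [GenR i]) 1"

text \<open>The two-sided ideal generated by the defining relations. It is closed under scalars
  and negation because these are multiplications by elements of the free algebra.\<close>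

inductive_set rel_ideal :: "('k::field, 'n) free_alg set" where
  rel_ll: "freeL i * freeL j - freeL j * freeL i \<in> rel_ideal"
| rel_rl: "freeR i * freeL j - (freeL j * freeR i + freeR i * freeR j) \<in> rel_ideal"
| zero: "0 \<in> rel_ideal"
| add: "x \<in> rel_ideal \<Longrightarrow> y \<in> rel_ideal \<Longrightarrow> x + y \<in> rel_ideal"
| mult_left: "x \<in> rel_ideal \<Longrightarrow> a * x \<in> rel_ideal"
| mult_right: "x \<in> rel_ideal \<Longrightarrow> x * a \<in> rel_ideal"

lemma rel_ideal_uminus: "x \<in> rel_ideal \<Longrightarrow> - x \<in> rel_ideal"
  using rel_ideal.mult_left[of x "- 1"] by simp

lemma rel_ideal_diff: "x \<in> rel_ideal \<Longrightarrow> y \<in> rel_ideal \<Longrightarrow> x - y \<in> rel_ideal"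
  using rel_ideal.add[OF _ rel_ideal_uminus, of x y] by simp

text \<open>The evaluation sending the \<open>l\<close>-generators to the variables and the \<open>r\<close>-generators
  to zero kills the ideal; hence the ideal is proper.\<close>

primrec gen_to_mpol :: "'n gen \<Rightarrow> ('k::field, 'n) mpol" where
  "gen_to_mpol (GenL i) = var i"
| "gen_to_mpol (GenR i) = 0"

definition free_to_mpol :: "('k::field, 'n) free_alg \<Rightarrow> ('k, 'n) mpol"
  where "free_to_mpol =
    pm_ext (\<lambda>w c. Poly_Mapping.single 0 c * prod_list (map gen_to_mpol (letters w)))"

lemma free_to_mpol_add: "free_to_mpol (p + q) = free_to_mpol p + free_to_mpol q"
  unfolding free_to_mpol_def by (rule pm_ext_add) (simp_all add: single_add distrib_right)

lemma free_to_mpol_mult: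
  fixes p q :: "('k::field, 'n) free_alg"
  shows "free_to_mpol (p * q) = free_to_mpol p * free_to_mpol q"
  unfolding free_to_mpol_def
proof (rule pm_ext_mult)
  fix v w :: "'n gen word" and c d :: 'k
  have "Poly_Mapping.single 0 (c * d) =
      (Poly_Mapping.single 0 c :: ('k, 'n) mpol) * Poly_Mapping.single 0 d"
    by (simp add: mult_single)
  then show "Poly_Mapping.single 0 (c * d) * prod_list (map gen_to_mpol (letters (v + w))) =
      Poly_Mapping.single 0 c * prod_list (map gen_to_mpol (letters v)) *
      (Poly_Mapping.single 0 d * prod_list (map gen_to_mpol (letters w)))"
    by (simp add: ac_simps)
qed (simp_all add: single_add distrib_right)

lemma free_to_mpol_single:
  "free_to_mpol (Poly_Mapping.single w c) =
     Poly_Mapping.single 0 c * prod_list (map gen_to_mpol (letters w))"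
  unfolding free_to_mpol_def by (rule pm_ext_single) simp

lemma free_to_mpol_1: "free_to_mpol 1 = 1"
  using free_to_mpol_single[of 0 1] by simp

lemma free_to_mpol_0: "free_to_mpol 0 = 0"
  by (simp add: free_to_mpol_def pm_ext_def)

lemma free_to_mpol_diff: "free_to_mpol (p - q) = free_to_mpol p - free_to_mpol q"
  by (metis add_diff_cancel diff_add_cancel free_to_mpol_add)

lemma free_to_mpol_freeL: "free_to_mpol (freeL i) = var i"
  by (simp add: freeL_def free_to_mpol_single)

lemma free_to_mpol_freeR: "free_to_mpol (freeR i) = 0"
  by (simp add: freeR_def free_to_mpol_single)

lemma free_to_mpol_ideal: "x \<in> rel_ideal \<Longrightarrow> free_to_mpol x = 0"
  by (induction rule: rel_ideal.induct)
    (simp_all add: free_to_mpol_add free_to_mpol_mult free_to_mpol_diff free_to_mpol_0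
      free_to_mpol_freeL free_to_mpol_freeR mult.commute)

lemma one_notin_rel_ideal: "1 \<notin> rel_ideal"
  by (metis free_to_mpol_ideal free_to_mpol_1 zero_neq_one)

definition rel_cong :: "('k::field, 'n) free_alg \<Rightarrow> ('k, 'n) free_alg \<Rightarrow> bool"
  where "rel_cong x y \<longleftrightarrow> x - y \<in> rel_ideal"

lemma equivp_rel_cong: "equivp (rel_cong :: ('k::field, 'n) free_alg \<Rightarrow> _)"
proof (rule equivpI)
  show "reflp (rel_cong :: ('k, 'n) free_alg \<Rightarrow> _)"
    by (simp add: reflp_def rel_cong_def rel_ideal.zero)
  show "symp (rel_cong :: ('k, 'n) free_alg \<Rightarrow> _)"
    unfolding symp_def rel_cong_def by (metis minus_diff_eq rel_ideal_uminus)
  show "transp (rel_cong :: ('k, 'n) free_alg \<Rightarrow> _)"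
  proof (rule transpI)
    fix x y z :: "('k, 'n) free_alg"
    assume "rel_cong x y" "rel_cong y z"
    then have "(x - y) + (y - z) \<in> rel_ideal"
      unfolding rel_cong_def by (rule rel_ideal.add)
    then show "rel_cong x z" by (simp add: rel_cong_def)
  qed
qed

quotient_type (overloaded) ('k, 'n) ualg = "('k::field, 'n) free_alg" / rel_cong
  morphisms rep_ualg ualg_of_free
  by (rule equivp_rel_cong)

instantiation ualg :: (field, type) ring_1
begin

lift_definition zero_ualg :: "('a, 'b) ualg" is 0 .

lift_definition one_ualg :: "('a, 'b) ualg" is 1 .

lift_definition plus_ualg :: "('a, 'b) ualg \<Rightarrow> ('a, 'b) ualg \<Rightarrow> ('a, 'b) ualg" is "(+)"
  unfolding rel_cong_def by (simp add: add_diff_add rel_ideal.add)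

lift_definition uminus_ualg :: "('a, 'b) ualg \<Rightarrow> ('a, 'b) ualg" is uminus
proof -
  fix x y :: "('a, 'b) free_alg"
  assume "rel_cong x y"
  then have "- (x - y) \<in> rel_ideal"
    unfolding rel_cong_def by (rule rel_ideal_uminus)
  then show "rel_cong (- x) (- y)"
    by (simp add: rel_cong_def)
qed

lift_definition minus_ualg :: "('a, 'b) ualg \<Rightarrow> ('a, 'b) ualg \<Rightarrow> ('a, 'b) ualg" is "(-)"
proof -
  fix x x' y y' :: "('a, 'b) free_alg"
  assume "rel_cong x x'" "rel_cong y y'"
  then have "(x - x') - (y - y') \<in> rel_ideal"
    unfolding rel_cong_def by (rule rel_ideal_diff)
  then show "rel_cong (x - y) (x' - y')"
    by (simp add: rel_cong_def algebra_simps)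
qed

lift_definition times_ualg :: "('a, 'b) ualg \<Rightarrow> ('a, 'b) ualg \<Rightarrow> ('a, 'b) ualg" is "(*)"
proof -
  fix x x' y y' :: "('a, 'b) free_alg"
  assume "rel_cong x x'" "rel_cong y y'"
  then have "x * (y - y') + (x - x') * y' \<in> rel_ideal"
    unfolding rel_cong_def by (intro rel_ideal.add rel_ideal.mult_left rel_ideal.mult_right)
  then show "rel_cong (x * y) (x' * y')"
    by (simp add: rel_cong_def algebra_simps)
qed

instance
proof
  show "(0 :: ('a, 'b) ualg) \<noteq> 1"
  proof transfer
    show "\<not> rel_cong 0 (1 :: ('a, 'b) free_alg)"
      using rel_ideal_uminus[of "- 1"] one_notin_rel_ideal by (auto simp: rel_cong_def)
  qed
qed (transfer, simp add: equivp_reflp[OF equivp_rel_cong] algebra_simps)+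

end

lift_definition scaleU :: "'k::field \<Rightarrow> ('k, 'n) ualg \<Rightarrow> ('k, 'n) ualg"
  is "\<lambda>c x. Poly_Mapping.single 0 c * x"
  unfolding rel_cong_def by (metis rel_ideal.mult_left right_diff_distrib)

lift_definition lgen :: "'n \<Rightarrow> ('k::field, 'n) ualg" is freeL .

lift_definition rgen :: "'n \<Rightarrow> ('k::field, 'n) ualg" is freeR .

lemma lgen_commute: "lgen i * lgen j = lgen j * lgen i"
  by transfer (simp add: rel_cong_def rel_ideal.rel_ll)

lemma rgen_lgen: "rgen i * lgen j = lgen j * rgen i + rgen i * rgen j"
  by transfer (simp add: rel_cong_def rel_ideal.rel_rl)

lemma vector_space_scaleU: "vector_space scaleU"
proof -
  note refl = equivp_reflp[OF equivp_rel_cong]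
  show ?thesis
    by unfold_locales
      (transfer, simp add: distrib_left distrib_right single_add mult_single refl
        flip: mult.assoc)+
qed

lemma single_zero_central:
  fixes x :: "('k::field, 'n) free_alg"
  shows "Poly_Mapping.single 0 c * x = x * Poly_Mapping.single 0 c"
  by (induction x rule: poly_mapping_single_induct)
    (simp_all add: mult_single distrib_left distrib_right mult.commute)

lemma scaleU_mult_left: "scaleU c x * y = scaleU c (x * y)"
  by transfer (simp add: equivp_reflp[OF equivp_rel_cong] mult.assoc)

lemma scaleU_mult_right: "x * scaleU c y = scaleU c (x * y)"
  by transfer
    (metis equivp_reflp[OF equivp_rel_cong] mult.assoc single_zero_central)

text \<open>The map \<open>incl\<close> below is evaluation at the \<open>l\<close>-generators, an injective algebra
  homomorphism (\<open>alg_hom_incl\<close>, \<open>incl_var\<close>, \<open>inj_incl\<close>) identifying the polynomial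
  algebra with the subalgebra they generate.\<close>

text \<open>The product over all indices is written as a fold because the ambient ring is not
  commutative; the factors commute, so the order of multiplication is irrelevant.\<close>

definition lmonom_on :: "('n \<Rightarrow>\<^sub>0 nat) \<Rightarrow> 'n set \<Rightarrow> ('k::field, 'n) ualg"
  where "lmonom_on m A = Finite_Set.fold (\<lambda>i x. lgen i ^ Poly_Mapping.lookup m i * x) 1 A"

definition lmonom :: "('n::finite \<Rightarrow>\<^sub>0 nat) \<Rightarrow> ('k::field, 'n) ualg"
  where "lmonom m = lmonom_on m UNIV"

definition incl :: "('k::field, 'n::finite) mpol \<Rightarrow> ('k, 'n) ualg"
  where "incl p = (\<Sum>m\<in>Poly_Mapping.keys p. scaleU (Poly_Mapping.lookup p m) (lmonom m))"

lemma lgen_power_commute: "lgen i ^ a * lgen j ^ b = lgen j ^ b * lgen i ^ a"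
proof -
  have "lgen i ^ a * lgen j = lgen j * lgen i ^ a" for a
    by (rule power_commuting_commutes) (rule lgen_commute)
  then show ?thesis
    by (metis power_commuting_commutes)
qed

lemma lmonom_on_empty [simp]: "lmonom_on m {} = 1"
  by (simp add: lmonom_on_def)

lemma lmonom_on_insert [simp]:
  assumes "finite A" "i \<notin> A"
  shows "(lmonom_on m (insert i A) :: ('k::field, 'n) ualg) =
    lgen i ^ Poly_Mapping.lookup m i * lmonom_on m A"
proof -
  interpret comp_fun_commute "\<lambda>i x. (lgen i :: ('k, 'n) ualg) ^ Poly_Mapping.lookup m i * x"
    by standard (simp add: fun_eq_iff lgen_power_commute flip: mult.assoc)
  show ?thesis unfolding lmonom_on_def using assms by (rule fold_insert)
qed

lemma lmonom_0: "lmonom 0 = (1 :: ('k::field, 'n::finite) ualg)"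
proof -
  have "lmonom_on 0 A = (1 :: ('k, 'n) ualg)" if "finite A" for A
    using that by (induction A) simp_all
  then show ?thesis by (simp add: lmonom_def)
qed

lemma lmonom_on_commute:
  assumes "finite A"
  shows "lmonom_on m A * lgen j ^ b = lgen j ^ b * (lmonom_on m A :: ('k::field, 'n) ualg)"
  using assms
proof (induction A)
  case (insert i A)
  then have "lmonom_on m (insert i A) * lgen j ^ b =
      (lgen i ^ Poly_Mapping.lookup m i * lgen j ^ b) * (lmonom_on m A :: ('k, 'n) ualg)"
    by (simp add: mult.assoc)
  also have "\<dots> = (lgen j ^ b * lgen i ^ Poly_Mapping.lookup m i) * (lmonom_on m A :: ('k, 'n) ualg)"
    by (simp only: lgen_power_commute)
  finally show ?case
    using insert by (simp add: mult.assoc)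
qed simp

lemma lmonom_add: "lmonom (m + m') = (lmonom m * lmonom m' :: ('k::field, 'n::finite) ualg)"
proof -
  have "lmonom_on (m + m') A = (lmonom_on m A * lmonom_on m' A :: ('k, 'n) ualg)" if "finite A" for A
    using that
  proof (induction A)
    case (insert i A)
    let ?a = "lgen i ^ Poly_Mapping.lookup m i :: ('k, 'n) ualg" and ?b = "lgen i ^ Poly_Mapping.lookup m' i :: ('k, 'n) ualg"
    have "lmonom_on (m + m') (insert i A) = ?a * (?b * lmonom_on m A) * lmonom_on m' A"
      using insert by (simp add: lookup_add power_add mult.assoc)
    also have "\<dots> = ?a * (lmonom_on m A * ?b) * lmonom_on m' A"
      using insert by (simp only: lmonom_on_commute)
    finally show ?case
      using insert by (simp add: mult.assoc)
  qed simp
  then show ?thesis by (simp add: lmonom_def)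
qed

lemma lmonom_single: "lmonom (Poly_Mapping.single j 1) = (lgen j :: ('k::field, 'n::finite) ualg)"
proof -
  have "lmonom_on (Poly_Mapping.single j 1) A = (if j \<in> A then lgen j else 1 :: ('k, 'n) ualg)"
    if "finite A" for A
    using that by (induction A) (auto simp: lookup_single when_def)
  then show ?thesis by (simp add: lmonom_def)
qed

lemma incl_eq_pm_ext: "incl = pm_ext (\<lambda>m c. scaleU c (lmonom m))"
  by (simp add: fun_eq_iff incl_def pm_ext_def)

lemma incl_single: "incl (Poly_Mapping.single m c) = scaleU c (lmonom m)"
proof -
  interpret vector_space scaleU by (rule vector_space_scaleU)
  show ?thesis unfolding incl_eq_pm_ext by (rule pm_ext_single) simp
qed

lemma alg_hom_incl: "alg_hom scaleP scaleU incl"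
proof -
  interpret P: vector_space scaleP by (rule vector_space_scaleP)
  interpret U: vector_space scaleU by (rule vector_space_scaleU)
  have add: "incl (p + q) = incl p + incl q" for p q :: "('a, 'b) mpol"
    unfolding incl_eq_pm_ext by (rule pm_ext_add) (simp_all add: U.scale_left_distrib)
  have mult: "incl (p * q) = incl p * incl q" for p q :: "('a, 'b) mpol"
    unfolding incl_eq_pm_ext
    by (rule pm_ext_mult)
      (simp_all add: U.scale_left_distrib lmonom_add scaleU_mult_left scaleU_mult_right mult.commute)
  have one: "incl 1 = (1 :: ('a, 'b) ualg)"
    using incl_single[of 0 1] by (simp add: lmonom_0)
  have scale: "incl (scaleP c p) = scaleU c (incl p)" for c and p :: "('a, 'b) mpol"
    by (simp add: scaleP_def mult incl_single lmonom_0 scaleU_mult_left)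
  show ?thesis
    unfolding alg_hom_def Vector_Spaces.linear_iff
    using add mult one scale vector_space_scaleP vector_space_scaleU by blast
qed

lemma incl_var: "incl (var i) = lgen i"
  using vector_space.vector_space_assms(4)[OF vector_space_scaleU]
  by (simp add: var_def incl_single lmonom_single del: One_nat_def)

lift_definition ualg_to_mpol :: "('k::field, 'n) ualg \<Rightarrow> ('k, 'n) mpol" is free_to_mpol
  unfolding rel_cong_def
  by (metis eq_iff_diff_eq_0 free_to_mpol_diff free_to_mpol_ideal)

lemma ualg_to_mpol_add: "ualg_to_mpol (x + y) = ualg_to_mpol x + ualg_to_mpol y"
  by transfer (rule free_to_mpol_add)

lemma ualg_to_mpol_mult: "ualg_to_mpol (x * y) = ualg_to_mpol x * ualg_to_mpol y"
  by transfer (rule free_to_mpol_mult)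

lemma ualg_to_mpol_0: "ualg_to_mpol 0 = 0"
  by transfer (rule free_to_mpol_0)

lemma ualg_to_mpol_1: "ualg_to_mpol 1 = 1"
  by transfer (rule free_to_mpol_1)

lemma ualg_to_mpol_scaleU: "ualg_to_mpol (scaleU c x) = scaleP c (ualg_to_mpol x)"
  by transfer (simp add: free_to_mpol_mult free_to_mpol_single scaleP_def)

lemma ualg_to_mpol_lgen: "ualg_to_mpol (lgen i) = var i"
  by transfer (rule free_to_mpol_freeL)

lemma ualg_to_mpol_lgen_power:
  "ualg_to_mpol (lgen i ^ a) = Poly_Mapping.single (Poly_Mapping.single i a) 1"
  by (induction a)
    (simp_all add: ualg_to_mpol_1 ualg_to_mpol_mult ualg_to_mpol_lgen var_def mult_single
      flip: single_add)

lemma ualg_to_mpol_lmonom: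
  "ualg_to_mpol (lmonom m :: ('k::field, 'n::finite) ualg) = Poly_Mapping.single m 1"
proof -
  have "ualg_to_mpol (lmonom_on m A :: ('k, 'n) ualg) =
      Poly_Mapping.single (\<Sum>i\<in>A. Poly_Mapping.single i (Poly_Mapping.lookup m i)) 1"
    if "finite A" for A
    using that
    by (induction A)
      (simp_all add: ualg_to_mpol_mult ualg_to_mpol_lgen_power mult_single ualg_to_mpol_1)
  moreover have "(\<Sum>i\<in>UNIV. Poly_Mapping.single i (Poly_Mapping.lookup m i)) = m"
  proof -
    have "(\<Sum>i\<in>UNIV. Poly_Mapping.single i (Poly_Mapping.lookup m i)) =
        (\<Sum>i\<in>Poly_Mapping.keys m. Poly_Mapping.single i (Poly_Mapping.lookup m i))"
      by (rule sum.mono_neutral_right) (auto simp: in_keys_iff)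
    then show ?thesis by (simp flip: poly_mapping_sum_single)
  qed
  ultimately show ?thesis by (simp add: lmonom_def)
qed

lemma ualg_to_mpol_incl: "ualg_to_mpol (incl p) = p"
proof (induction p rule: poly_mapping_single_induct)
  case zero
  then show ?case by (simp add: incl_def ualg_to_mpol_0)
next
  case (single m c)
  then show ?case
    by (simp add: incl_single ualg_to_mpol_scaleU ualg_to_mpol_lmonom scaleP_def mult_single)
next
  case (add p q)
  have "incl (p + q) = incl p + incl q"
    using alg_hom_incl unfolding alg_hom_def Vector_Spaces.linear_iff by blast
  with add show ?case by (simp add: ualg_to_mpol_add)
qed

lemma inj_incl: "inj incl"
  by (metis injI ualg_to_mpol_incl)

abbreviation AutL :: "(('k::field, 'n) mpol \<Rightarrow> ('k, 'n) mpol) monoid"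
  where "AutL \<equiv> alg_Aut scaleP"

abbreviation AutU :: "(('k::field, 'n) ualg \<Rightarrow> ('k, 'n) ualg) monoid"
  where "AutU \<equiv> alg_Aut scaleU"

text \<open>The predicate \<open>is_star \<phi> \<psi>\<close> says that \<open>\<psi>\<close> is an algebra endomorphism with
  the prescribed values on generators; well-definedness of the extension of \<open>\<phi>\<close> means
  that exactly one such \<open>\<psi>\<close> exists.\<close>

definition is_star ::
    "(('k::field, 'n::finite) mpol \<Rightarrow> ('k, 'n) mpol) \<Rightarrow> (('k, 'n) ualg \<Rightarrow> ('k, 'n) ualg) \<Rightarrow> bool"
  where "is_star \<phi> \<psi> \<longleftrightarrow> alg_hom scaleU scaleU \<psi> \<and>
    (\<forall>i. \<psi> (lgen i) = incl (\<phi> (var i))) \<and>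
    (\<forall>i. \<psi> (rgen i) = (\<Sum>s\<in>UNIV. incl (pderivative s (\<phi> (var i))) * rgen s))"

definition star ::
    "(('k::field, 'n::finite) mpol \<Rightarrow> ('k, 'n) mpol) \<Rightarrow> (('k, 'n) ualg \<Rightarrow> ('k, 'n) ualg)"
  where "star \<phi> = (THE \<psi>. is_star \<phi> \<psi>)"

end

(* The total differential d p = sum_s (dp/dl_s) r_s of a polynomial p satisfies the Leibniz rule
   and, in U_n, the identity (d p) q = q (d p) + (d p)(d q). For variables p and q this is the
   second defining relation; both sides are linear over polynomials in d p and compatible with
   products in q. Taking p and q to be phi(l_i) and phi(l_j) shows that phi* respects the
   relations. The chain rule phi*(d p) = d(phi p), which again need only be checked on variables,
   gives functoriality of the star. *)

theory Submission
  imports Defs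
begin

section \<open>Algebra homomorphisms\<close>

lemma alg_hom_add: "alg_hom sA sB f \<Longrightarrow> f (x + y) = f x + f y"
  and alg_hom_scale: "alg_hom sA sB f \<Longrightarrow> f (sA c x) = sB c (f x)"
  and alg_hom_1: "alg_hom sA sB f \<Longrightarrow> f 1 = 1"
  and alg_hom_mult: "alg_hom sA sB f \<Longrightarrow> f (x * y) = f x * f y"
  by (simp_all add: alg_hom_def Vector_Spaces.linear_iff)

lemma alg_hom_0: "alg_hom sA sB f \<Longrightarrow> f 0 = 0"
  using alg_hom_add[of sA sB f 0 0] by simp

lemma alg_homI:
  assumes "vector_space sA" "vector_space sB" "\<And>x y. f (x + y) = f x + f y"
    "\<And>c x. f (sA c x) = sB c (f x)" "f 1 = 1" "\<And>x y. f (x * y) = f x * f y"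
  shows "alg_hom sA sB f"
  using assms by (simp add: alg_hom_def Vector_Spaces.linear_iff)

lemma alg_hom_id: "vector_space s \<Longrightarrow> alg_hom s s id"
  by (rule alg_homI) simp_all

lemma alg_hom_comp:
  assumes "alg_hom sA sB f" "alg_hom sB sC g"
  shows "alg_hom sA sC (g \<circ> f)"
  using assms by (simp add: alg_hom_def Vector_Spaces.linear_iff)

lemma alg_hom_inv:
  assumes "alg_hom sA sB f" "bij f"
  shows "alg_hom sB sA (inv_into UNIV f)"
proof -
  \<comment> \<open>With this, each law for the inverse is checked after applying \<open>f\<close>,
    where it becomes the law for \<open>f\<close> together with surjectivity.\<close>
  have eq: "inv_into UNIV f y = x" if "f x = y" for x y
    using that bij_is_inj[OF assms(2)] by (auto simp: inv_f_f)
  show ?thesis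
  proof (rule alg_homI)
    show "vector_space sB" "vector_space sA"
      using assms(1) by (simp_all add: alg_hom_def Vector_Spaces.linear_iff)
  qed (rule eq, simp add: alg_hom_add[OF assms(1)] alg_hom_scale[OF assms(1)] alg_hom_1[OF assms(1)]
      alg_hom_mult[OF assms(1)] surj_f_inv_f[OF bij_is_surj[OF assms(2)]])+
qed

lemma carrier_alg_Aut: "f \<in> carrier (alg_Aut s) \<longleftrightarrow> alg_hom s s f \<and> bij f"
  and mult_alg_Aut: "f \<otimes>\<^bsub>alg_Aut s\<^esub> g = f \<circ> g"
  and one_alg_Aut: "\<one>\<^bsub>alg_Aut s\<^esub> = id"
  by (simp_all add: alg_Aut_def)

lemma group_alg_Aut:
  assumes "vector_space s"
  shows "group (alg_Aut s)"
proof (rule groupI)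
  fix f assume "f \<in> carrier (alg_Aut s)"
  then show "\<exists>g\<in>carrier (alg_Aut s). g \<otimes>\<^bsub>alg_Aut s\<^esub> f = \<one>\<^bsub>alg_Aut s\<^esub>"
    by (intro bexI[of _ "inv_into UNIV f"])
      (auto simp: carrier_alg_Aut mult_alg_Aut one_alg_Aut alg_hom_inv bij_imp_bij_inv bij_is_inj)
qed (auto simp: carrier_alg_Aut mult_alg_Aut one_alg_Aut alg_hom_comp alg_hom_id bij_comp assms
    comp_assoc)

section \<open>Polynomials and partial derivatives\<close>

lemma scaleP_single: "scaleP c (Poly_Mapping.single m d) = Poly_Mapping.single m (c * d)"
  by (simp add: scaleP_def mult_single)

text \<open>Every monomial is a product of variables, every term is a scalar multiple of a monomial,
  and 0 is 1 scaled by 0. The cases are exactly the operations with which homomorphisms and the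
  differential are compatible.\<close>

lemma mpol_induct [case_names one var add scale mult]:
  fixes p :: "('k::field, 'n) mpol"
  assumes "P 1" "\<And>i. P (var i)" "\<And>p q. P p \<Longrightarrow> P q \<Longrightarrow> P (p + q)"
    "\<And>c p. P p \<Longrightarrow> P (scaleP c p)" "\<And>p q. P p \<Longrightarrow> P q \<Longrightarrow> P (p * q)"
  shows "P p"
proof (induction p rule: poly_mapping_single_induct)
  have single: "P (Poly_Mapping.single m 1)" for m
  proof (induction m rule: poly_mapping_single_induct)
    case (single i a)
    show ?case
    proof (induction a)
      case (Suc a)
      have "Poly_Mapping.single (Poly_Mapping.single i (Suc a)) 1 =
          (var i * Poly_Mapping.single (Poly_Mapping.single i a) 1 :: ('k, 'n) mpol)"
        by (simp add: var_def mult_single flip: single_add)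
      with Suc assms(2,5) show ?case by simp
    qed (use assms(1) in simp)
  next
    case (add m m')
    have "Poly_Mapping.single (m + m') 1 =
        (Poly_Mapping.single m 1 * Poly_Mapping.single m' 1 :: ('k, 'n) mpol)"
      by (simp add: mult_single)
    with add assms(5) show ?case by simp
  qed (use assms(1) in simp)
  show "P (Poly_Mapping.single m c)" for m c
    using assms(4)[OF single, of c m] by (simp add: scaleP_single)
  show "P 0"
    using assms(4)[OF assms(1), of 0] by (simp add: scaleP_def)
qed (use assms(3) in blast)

lemma pderivative_eq_pm_ext:
  "pderivative s = pm_ext (\<lambda>m c. Poly_Mapping.single (m - Poly_Mapping.single s 1)
     (of_nat (Poly_Mapping.lookup m s) * c))"
  by (simp add: fun_eq_iff pderivative_def pm_ext_def)

lemma pderivative_add: "pderivative s (p + q) = pderivative s p + pderivative s q"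
  unfolding pderivative_eq_pm_ext by (rule pm_ext_add) (simp_all add: distrib_left single_add)

lemma pderivative_single:
  "pderivative s (Poly_Mapping.single m c) =
     Poly_Mapping.single (m - Poly_Mapping.single s 1) (of_nat (Poly_Mapping.lookup m s) * c)"
  unfolding pderivative_eq_pm_ext by (rule pm_ext_single) simp

lemma pderivative_0: "pderivative s 0 = 0"
  by (simp add: pderivative_def)

lemma pderivative_var: "pderivative s (var i) = (if s = i then 1 else 0)"
  by (auto simp: var_def pderivative_single lookup_single)

text \<open>Subtraction of exponents is truncated; it commutes with adding \<open>m'\<close> because
  the exponent of \<open>s\<close> in \<open>m\<close> is at least 1.\<close>

lemma exponent_diff_add:
  fixes m m' :: "'n \<Rightarrow>\<^sub>0 nat"
  assumes "Poly_Mapping.lookup m s \<noteq> 0"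
  shows "m - Poly_Mapping.single s 1 + m' = m + m' - Poly_Mapping.single s 1"
  using assms
  by (intro poly_mapping_eqI) (auto simp: lookup_add lookup_minus lookup_single when_def)

text \<open>Both sides are additive in \<open>p\<close> and in \<open>q\<close>, so single terms
  suffice.\<close>

lemma pderivative_mult:
  fixes p q :: "('k::field, 'n) mpol"
  shows "pderivative s (p * q) = p * pderivative s q + q * pderivative s p"
proof (induction p rule: poly_mapping_single_induct)
  case zero
  then show ?case by (simp add: pderivative_0)
next
  case (add p p')
  then show ?case by (simp add: pderivative_add algebra_simps)
next
  case (single m c)
  show ?case
  proof (induction q rule: poly_mapping_single_induct)
    case zero
    then show ?case by (simp add: pderivative_0)
  next
    case (add q q')
    then show ?case by (simp add: pderivative_add algebra_simps)
  next
    case (single m' d)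
    let ?e = "Poly_Mapping.single s (1::nat)"
    let ?a = "Poly_Mapping.lookup m s" and ?b = "Poly_Mapping.lookup m' s"
    \<comment> \<open>When \<open>?b\<close> is 0 the subtraction of exponents may truncate, but
      then both coefficients vanish; otherwise \<open>exponent_diff_add\<close> aligns the
      exponents.\<close>
    have 1: "Poly_Mapping.single m c * pderivative s (Poly_Mapping.single m' d) =
        Poly_Mapping.single (m + m' - ?e) (of_nat ?b * (c * d))"
      using exponent_diff_add[of m' s m]
      by (cases "?b = 0") (simp_all add: pderivative_single mult_single add.commute mult.left_commute)
    have 2: "Poly_Mapping.single m' d * pderivative s (Poly_Mapping.single m c) =
        Poly_Mapping.single (m + m' - ?e) (of_nat ?a * (c * d))"
      using exponent_diff_add[of m s m']
      by (cases "?a = 0") (simp_all add: pderivative_single mult_single add.commute ac_simps)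
    have "pderivative s (Poly_Mapping.single m c * Poly_Mapping.single m' d) =
        Poly_Mapping.single (m + m' - ?e) (of_nat ?b * (c * d)) +
        Poly_Mapping.single (m + m' - ?e) (of_nat ?a * (c * d))"
      by (simp add: mult_single pderivative_single lookup_add distrib_right flip: single_add)
        (simp add: add.commute)
    then show ?case by (simp only: 1 2)
  qed
qed

lemma pderivative_1: "pderivative s 1 = 0"
  using pderivative_single[of s 0 1] by simp

lemma pderivative_scaleP: "pderivative s (scaleP c p) = scaleP c (pderivative s p)"
proof -
  have "pderivative s (Poly_Mapping.single 0 c) = 0"
    by (simp add: pderivative_single)
  then show ?thesis by (simp add: scaleP_def pderivative_mult)
qed

section \<open>Homomorphisms out of \<open>U\<^sub>n\<close>\<close>

primrec gen_to_ualg :: "('n \<Rightarrow> 'a) \<Rightarrow> ('n \<Rightarrow> 'a) \<Rightarrow> 'n gen \<Rightarrow> 'a" where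
  "gen_to_ualg L R (GenL i) = L i"
| "gen_to_ualg L R (GenR i) = R i"

text \<open>The homomorphism given by the universal property of the free algebra, with
  \<open>L\<close> and \<open>R\<close> as the images of the two families of generators.\<close>

definition free_eval ::
    "('n \<Rightarrow> ('k, 'm) ualg) \<Rightarrow> ('n \<Rightarrow> ('k, 'm) ualg) \<Rightarrow> ('k::field, 'n) free_alg \<Rightarrow> ('k, 'm) ualg"
  where "free_eval L R =
    pm_ext (\<lambda>w c. scaleU c (prod_list (map (gen_to_ualg L R) (letters w))))"

lemma scaleU_0_left: "scaleU 0 x = 0"
  and scaleU_1_left: "scaleU 1 x = x"
  and scaleU_add_left: "scaleU (c + d) x = scaleU c x + scaleU d x"
  and scaleU_add_right: "scaleU c (x + y) = scaleU c x + scaleU c y"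
  and scaleU_scaleU: "scaleU c (scaleU d x) = scaleU (c * d) x"
proof -
  interpret vector_space "scaleU :: 'a \<Rightarrow> ('a, 'b) ualg \<Rightarrow> _" by (rule vector_space_scaleU)
  show "scaleU 0 x = 0" "scaleU 1 x = x" "scaleU (c + d) x = scaleU c x + scaleU d x"
    "scaleU c (x + y) = scaleU c x + scaleU c y" "scaleU c (scaleU d x) = scaleU (c * d) x"
    by (simp_all add: scale_left_distrib scale_right_distrib)
qed

lemma free_eval_add: "free_eval L R (p + q) = free_eval L R p + free_eval L R q"
  unfolding free_eval_def by (rule pm_ext_add) (simp_all add: scaleU_0_left scaleU_add_left)

lemma free_eval_mult: "free_eval L R (p * q) = free_eval L R p * free_eval L R q"
  unfolding free_eval_def
  by (rule pm_ext_mult)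
    (simp_all add: scaleU_0_left scaleU_add_left scaleU_mult_left scaleU_mult_right scaleU_scaleU
      mult.commute)

lemma free_eval_single:
  "free_eval L R (Poly_Mapping.single w c) =
     scaleU c (prod_list (map (gen_to_ualg L R) (letters w)))"
  unfolding free_eval_def by (rule pm_ext_single) (simp add: scaleU_0_left)

lemma free_eval_0: "free_eval L R 0 = 0"
  by (simp add: free_eval_def pm_ext_def)

lemma free_eval_1: "free_eval L R 1 = 1"
  using free_eval_single[of L R 0 1] by (simp add: scaleU_1_left)

lemma free_eval_diff: "free_eval L R (p - q) = free_eval L R p - free_eval L R q"
  by (metis add_diff_cancel diff_add_cancel free_eval_add)

lemma free_eval_freeL: "free_eval L R (freeL i) = L i"
  by (simp add: freeL_def free_eval_single scaleU_1_left)

lemma free_eval_freeR: "free_eval L R (freeR i) = R i"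
  by (simp add: freeR_def free_eval_single scaleU_1_left)

section \<open>Generation of U_n and its universal property\<close>

lemma ualg_of_free_rep: "ualg_of_free (rep_ualg x) = x"
  by (rule Quotient3_abs_rep[OF Quotient3_ualg])

text \<open>The quotient map is multiplicative, so the class of a word is the product of the classes
  of its letters. This shows that U_n is spanned by products of generators.\<close>

lemma ualg_of_free_single:
  fixes w :: "'n gen word" and c :: "'k::field"
  shows "ualg_of_free (Poly_Mapping.single w c) =
     scaleU c (prod_list (map (gen_to_ualg lgen rgen) (letters w)))"
proof -
  have gen: "ualg_of_free (Poly_Mapping.single (Word [g]) 1) =
      (gen_to_ualg lgen rgen g :: ('k, 'n) ualg)" for g
    by (cases g) (simp_all add: lgen.abs_eq rgen.abs_eq freeL_def freeR_def)
  have "ualg_of_free (Poly_Mapping.single (Word gs) 1) =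
      (prod_list (map (gen_to_ualg lgen rgen) gs) :: ('k, 'n) ualg)" for gs
  proof (induction gs)
    case Nil
    then show ?case by (simp add: one_ualg.abs_eq flip: zero_word_def)
  next
    case (Cons g gs)
    have "Poly_Mapping.single (Word (g # gs)) 1 =
        (Poly_Mapping.single (Word [g]) 1 * Poly_Mapping.single (Word gs) 1 :: ('k, 'n) free_alg)"
      by (simp add: mult_single plus_word_def)
    with Cons gen show ?case by (simp add: times_ualg.abs_eq[symmetric])
  qed
  from this[of "letters w"] have
    "ualg_of_free (Poly_Mapping.single w 1) =
      (prod_list (map (gen_to_ualg lgen rgen) (letters w)) :: ('k, 'n) ualg)"
    by simp
  moreover have "Poly_Mapping.single w c =
      (Poly_Mapping.single 0 c * Poly_Mapping.single w 1 :: ('k, 'n) free_alg)"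
    by (simp add: mult_single)
  ultimately show ?thesis by (simp add: scaleU.abs_eq[symmetric])
qed

text \<open>Every element is the class of a sum of scaled words, and the class of a word is a
  product of generators.\<close>

lemma ualg_gen_induct [case_names one lgen rgen add scale mult]:
  fixes x :: "('k::field, 'n) ualg"
  assumes "P 1" "\<And>i. P (lgen i)" "\<And>i. P (rgen i)" "\<And>x y. P x \<Longrightarrow> P y \<Longrightarrow> P (x + y)"
    "\<And>c x. P x \<Longrightarrow> P (scaleU c x)" "\<And>x y. P x \<Longrightarrow> P y \<Longrightarrow> P (x * y)"
  shows "P x"
proof -
  have gen: "P (gen_to_ualg lgen rgen g)" for g
    by (cases g) (simp_all add: assms)
  have list: "P (prod_list (map (gen_to_ualg lgen rgen) gs))" for gs
    by (induction gs) (simp_all add: assms gen)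
  have "P (ualg_of_free p)" for p
  proof (induction p rule: poly_mapping_single_induct)
    case zero
    show ?case using assms(5)[OF assms(1), of 0] by (simp add: scaleU_0_left zero_ualg.abs_eq)
  next
    case (single w c)
    show ?case by (simp add: ualg_of_free_single assms(5) list)
  next
    case (add p q)
    then show ?case using assms(4) by (simp add: plus_ualg.abs_eq[symmetric])
  qed
  from this[of "rep_ualg x"] show ?thesis by (simp add: ualg_of_free_rep)
qed

lemma alg_hom_ualg_eqI:
  assumes "alg_hom scaleU sB f" "alg_hom scaleU sB g"
    "\<And>i. f (lgen i) = g (lgen i)" "\<And>i. f (rgen i) = g (rgen i)"
  shows "f = g"
proof
  show "f x = g x" for x
    by (induction x rule: ualg_gen_induct)
      (use assms in \<open>simp_all add: alg_hom_1[of scaleU sB] alg_hom_add[of scaleU sB]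
        alg_hom_scale[of scaleU sB] alg_hom_mult[of scaleU sB]\<close>)
qed

lemma alg_hom_mpol_eqI:
  assumes "alg_hom scaleP sB f" "alg_hom scaleP sB g" "\<And>i. f (var i) = g (var i)"
  shows "f = g"
proof
  show "f x = g x" for x
    by (induction x rule: mpol_induct)
      (use assms in \<open>simp_all add: alg_hom_1[of scaleP sB] alg_hom_add[of scaleP sB]
        alg_hom_scale[of scaleP sB] alg_hom_mult[of scaleP sB]\<close>)
qed

text \<open>The universal property of U_n: if the proposed images satisfy the defining relations,
  evaluation kills the ideal and descends to the quotient.\<close>

lemma ex_alg_hom_ualg:
  fixes L R :: "'n \<Rightarrow> ('k::field, 'm) ualg"
  assumes ll: "\<And>i j. L i * L j = L j * L i"
    and rl: "\<And>i j. R i * L j = L j * R i + R i * R j"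
  obtains \<psi> where "alg_hom scaleU scaleU \<psi>" "\<And>i. \<psi> (lgen i) = L i" "\<And>i. \<psi> (rgen i) = R i"
proof -
  \<comment> \<open>\<open>rep_ualg\<close> picks some representative; \<open>cong\<close> below
    shows that the choice does not affect the value.\<close>
  define \<psi> where "\<psi> x = free_eval L R (rep_ualg x)" for x
  have "free_eval L R x = 0" if "x \<in> rel_ideal" for x
    using that
    by induction (simp_all add: free_eval_diff free_eval_mult free_eval_add free_eval_0
        free_eval_freeL free_eval_freeR ll rl)
  then have cong: "free_eval L R x = free_eval L R y" if "rel_cong x y" for x y
    using that free_eval_diff[of L R x y] by (simp add: rel_cong_def)
  have abs: "\<psi> (ualg_of_free p) = free_eval L R p" for p
    unfolding \<psi>_def by (rule cong) (simp add: ualg_of_free_rep flip: ualg.abs_eq_iff)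
  have ex: "\<exists>p. x = ualg_of_free p" for x :: "('k, 'n) ualg"
    by (metis ualg_of_free_rep)
  show ?thesis
  proof
    show "alg_hom scaleU scaleU \<psi>"
    proof (rule alg_homI[OF vector_space_scaleU vector_space_scaleU])
      fix x y :: "('k, 'n) ualg" and c
      obtain p q where [simp]: "x = ualg_of_free p" "y = ualg_of_free q"
        using ex by metis
      show "\<psi> (x + y) = \<psi> x + \<psi> y"
        by (simp add: plus_ualg.abs_eq abs free_eval_add)
      show "\<psi> (x * y) = \<psi> x * \<psi> y"
        by (simp add: times_ualg.abs_eq abs free_eval_mult)
      show "\<psi> (scaleU c x) = scaleU c (\<psi> x)"
        by (simp add: scaleU.abs_eq abs free_eval_mult free_eval_single scaleU_mult_left)
      show "\<psi> 1 = 1"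
        by (simp add: one_ualg.abs_eq abs free_eval_1)
    qed
    show "\<psi> (lgen i) = L i" "\<psi> (rgen i) = R i" for i
      by (simp_all add: lgen.abs_eq rgen.abs_eq abs free_eval_freeL free_eval_freeR)
  qed
qed

section \<open>The total differential\<close>

text \<open>Here \<open>rgen s\<close> stands for the differential of the variable \<open>s\<close>.
  Coefficients are on the left, since \<open>rgen s\<close> does not commute with
  polynomials.\<close>

definition total_diff :: "('k::field, 'n::finite) mpol \<Rightarrow> ('k, 'n) ualg"
  where "total_diff p = (\<Sum>s\<in>UNIV. incl (pderivative s p) * rgen s)"

lemmas incl_add = alg_hom_add[OF alg_hom_incl]
  and incl_scaleP = alg_hom_scale[OF alg_hom_incl]
  and incl_mult = alg_hom_mult[OF alg_hom_incl]
  and incl_1 = alg_hom_1[OF alg_hom_incl]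
  and incl_0 = alg_hom_0[OF alg_hom_incl]

lemma incl_commute: "incl p * incl q = incl q * incl p"
  by (metis incl_mult mult.commute)

lemma total_diff_add: "total_diff (p + q) = total_diff p + total_diff q"
  by (simp add: total_diff_def pderivative_add incl_add distrib_right sum.distrib)

lemma total_diff_mult: "total_diff (p * q) = incl p * total_diff q + incl q * total_diff p"
  by (simp add: total_diff_def pderivative_mult incl_add incl_mult distrib_right sum.distrib
      sum_distrib_left mult.assoc)

lemma total_diff_1: "total_diff 1 = 0"
  by (simp add: total_diff_def pderivative_1 incl_0)

lemma total_diff_scaleP: "total_diff (scaleP c p) = scaleU c (total_diff p)"
proof -
  interpret vector_space "scaleU :: 'a \<Rightarrow> ('a, 'b) ualg \<Rightarrow> _" by (rule vector_space_scaleU)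
  show ?thesis
    by (simp add: total_diff_def pderivative_scaleP incl_scaleP scaleU_mult_left scale_sum_right)
qed

lemma total_diff_var: "total_diff (var i) = (rgen i :: ('k::field, 'n::finite) ualg)"
proof -
  have "incl (pderivative s (var i)) * rgen s = (if s = i then rgen s else 0 :: ('k, 'n) ualg)" for s
    by (simp add: pderivative_var incl_0 incl_1)
  then show ?thesis by (simp add: total_diff_def)
qed

text \<open>The differential of \<open>p\<close> is a left combination of the \<open>rgen t\<close>,
  and polynomials commute, so the identity for each \<open>rgen t\<close> can be multiplied by its
  coefficient and summed. Keeping \<open>q\<close> fixed in the assumption allows its use inside the
  induction on \<open>q\<close> that follows.\<close>

lemma total_diff_mult_incl_aux:
  assumes "\<And>t. rgen t * incl q = incl q * rgen t + rgen t * total_diff q"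
  shows "total_diff p * incl q = incl q * total_diff p + total_diff p * total_diff q"
proof -
  have "incl (pderivative t p) * (rgen t * incl q) =
      incl q * (incl (pderivative t p) * rgen t) + incl (pderivative t p) * rgen t * total_diff q"
    for t
    by (simp add: assms distrib_left mult.assoc[symmetric] incl_commute[of q])
  then show ?thesis
    by (simp add: total_diff_def[of p] sum_distrib_right sum_distrib_left sum.distrib mult.assoc)
qed

text \<open>For a variable \<open>q\<close> this is the second defining relation. The index
  \<open>s\<close> is left arbitrary because the product case needs the induction hypothesis for all
  generators at once.\<close>

lemma rgen_mult_incl:
  "rgen s * incl q = incl q * rgen s + rgen s * total_diff q"
proof (induction q arbitrary: s rule: mpol_induct)
  case one
  then show ?case by (simp add: incl_1 total_diff_1)
next
  case (var i)
  then show ?case by (simp add: incl_var total_diff_var rgen_lgen)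
next
  case (add p q)
  then show ?case by (simp add: incl_add total_diff_add distrib_left distrib_right)
next
  case (scale c p)
  then show ?case
    by (simp add: incl_scaleP total_diff_scaleP scaleU_mult_left scaleU_mult_right scaleU_add_right)
next
  case (mult p q)
  have "rgen s * incl (p * q) = (incl p * rgen s + rgen s * total_diff p) * incl q"
    by (simp add: incl_mult mult.IH(1) flip: mult.assoc)
  also have "\<dots> = incl p * (rgen s * incl q) + rgen s * (total_diff p * incl q)"
    by (simp add: distrib_right mult.assoc)
  \<comment> \<open>The factor \<open>q\<close> is moved to the left past \<open>rgen s\<close> by
    its induction hypothesis, and past the differential of \<open>p\<close> by the preceding
    lemma.\<close>
  also have "\<dots> = incl p * (incl q * rgen s + rgen s * total_diff q) +
      rgen s * (incl q * total_diff p + total_diff p * total_diff q)"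
    by (simp only: mult.IH(2) total_diff_mult_incl_aux[OF mult.IH(2)])
  also have "\<dots> = incl p * incl q * rgen s +
      (incl p * rgen s + rgen s * total_diff p) * total_diff q + rgen s * incl q * total_diff p"
    by (simp add: distrib_left distrib_right mult.assoc)
  \<comment> \<open>The bracket is the expansion of \<open>rgen s * incl p\<close>. Folding it back
    leaves \<open>rgen s\<close> times the two terms of the Leibniz rule for
    \<open>p * q\<close>.\<close>
  also have "\<dots> = incl p * incl q * rgen s +
      rgen s * incl p * total_diff q + rgen s * incl q * total_diff p"
    by (simp only: mult.IH(1))
  finally show ?case
    by (simp add: incl_mult total_diff_mult distrib_left mult.assoc add.assoc)
qed

lemmas total_diff_mult_incl = total_diff_mult_incl_aux[OF rgen_mult_incl]

section \<open>The star construction\<close>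

lemma is_star_iff:
  "is_star \<phi> \<psi> \<longleftrightarrow> alg_hom scaleU scaleU \<psi> \<and>
    (\<forall>i. \<psi> (lgen i) = incl (\<phi> (var i))) \<and> (\<forall>i. \<psi> (rgen i) = total_diff (\<phi> (var i)))"
  by (simp add: is_star_def total_diff_def)

text \<open>Existence is the universal property: the images of the \<open>lgen i\<close> commute as
  polynomials, and \<open>total_diff_mult_incl\<close> for the polynomials
  \<open>\<phi> (var i)\<close> and \<open>\<phi> (var j)\<close> is the second relation. Uniqueness
  holds because the generators determine a homomorphism.\<close>

lemma ex1_is_star: "\<exists>!\<psi>. is_star \<phi> \<psi>"
proof (rule ex_ex1I)
  obtain \<psi> where "alg_hom scaleU scaleU \<psi>" "\<And>i. \<psi> (lgen i) = incl (\<phi> (var i))"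
    "\<And>i. \<psi> (rgen i) = total_diff (\<phi> (var i))"
    by (rule ex_alg_hom_ualg[of "\<lambda>i. incl (\<phi> (var i))" "\<lambda>i. total_diff (\<phi> (var i))"])
      (blast intro: incl_commute total_diff_mult_incl)+
  then show "\<exists>\<psi>. is_star \<phi> \<psi>" by (auto simp: is_star_iff)
next
  fix \<psi> \<psi>' assume "is_star \<phi> \<psi>" "is_star \<phi> \<psi>'"
  then show "\<psi> = \<psi>'"
    unfolding is_star_iff by (intro alg_hom_ualg_eqI[of scaleU]) simp_all
qed

lemma is_star_star: "is_star \<phi> (star \<phi>)"
  unfolding star_def by (rule theI'[OF ex1_is_star])

lemma star_eqI: "is_star \<phi> \<psi> \<Longrightarrow> star \<phi> = \<psi>"
  using ex1_is_star is_star_star by blast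

lemma alg_hom_star: "alg_hom scaleU scaleU (star \<phi>)"
  and star_lgen: "star \<phi> (lgen i) = incl (\<phi> (var i))"
  and star_rgen: "star \<phi> (rgen i) = total_diff (\<phi> (var i))"
  using is_star_star[of \<phi>] by (simp_all add: is_star_iff)

text \<open>Both sides are homomorphisms in \<open>p\<close> that agree on variables, so
  \<open>star \<phi>\<close> extends \<open>\<phi>\<close>.\<close>

lemma star_incl:
  assumes "alg_hom scaleP scaleP \<phi>"
  shows "star \<phi> (incl p) = incl (\<phi> p)"
proof -
  have "star \<phi> \<circ> incl = incl \<circ> \<phi>"
    by (rule alg_hom_mpol_eqI[of scaleU])
      (auto intro: alg_hom_comp alg_hom_incl alg_hom_star assms simp: incl_var star_lgen)
  then show ?thesis by (simp add: fun_eq_iff)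
qed

text \<open>The chain rule. On variables it is the prescribed value on \<open>rgen i\<close>; for
  products, both sides obey the same Leibniz rule once \<open>star_incl\<close> has handled the
  coefficients.\<close>

lemma star_total_diff:
  assumes "alg_hom scaleP scaleP \<phi>"
  shows "star \<phi> (total_diff p) = total_diff (\<phi> p)"
proof (induction p rule: mpol_induct)
  case one
  then show ?case
    by (simp add: total_diff_1 alg_hom_0[OF alg_hom_star] alg_hom_1[OF assms])
next
  case (var i)
  then show ?case by (simp add: total_diff_var star_rgen)
next
  case (add p q)
  then show ?case
    by (simp add: total_diff_add alg_hom_add[OF alg_hom_star] alg_hom_add[OF assms])
next
  case (scale c p)
  then show ?case
    by (simp add: total_diff_scaleP alg_hom_scale[OF alg_hom_star] alg_hom_scale[OF assms])
next
  case (mult p q)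
  then show ?case
    by (simp add: total_diff_mult alg_hom_add[OF alg_hom_star] alg_hom_mult[OF alg_hom_star]
        alg_hom_mult[OF assms] star_incl[OF assms])
qed

section \<open>Functoriality and injectivity of the star\<close>

lemma star_comp:
  assumes "alg_hom scaleP scaleP \<phi>"
  shows "star (\<phi> \<circ> \<chi>) = star \<phi> \<circ> star \<chi>"
  \<comment> \<open>By uniqueness it is enough to compare generators: on \<open>lgen i\<close> by
    \<open>star_incl\<close>, on \<open>rgen i\<close> by the chain rule applied to
    \<open>\<chi> (var i)\<close>.\<close>
  by (rule star_eqI)
    (auto simp: is_star_iff star_lgen star_rgen star_incl[OF assms] star_total_diff[OF assms]
      intro: alg_hom_comp alg_hom_star)

lemma star_id: "star id = id"
  by (rule star_eqI)
    (simp add: is_star_iff incl_var total_diff_var alg_hom_id vector_space_scaleU)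

lemma star_in_AutU:
  assumes "\<phi> \<in> carrier AutL"
  shows "star \<phi> \<in> carrier AutU"
proof -
  from assms have \<phi>: "alg_hom scaleP scaleP \<phi>" "bij \<phi>"
    by (simp_all add: carrier_alg_Aut)
  \<comment> \<open>Functoriality turns the star of the inverse into a two-sided inverse of
    \<open>star \<phi>\<close>.\<close>
  have "star \<phi> \<circ> star (inv_into UNIV \<phi>) = id" "star (inv_into UNIV \<phi>) \<circ> star \<phi> = id"
    using \<phi> surj_iff[of \<phi>]
    by (simp_all add: star_id bij_is_inj bij_is_surj alg_hom_inv flip: star_comp)
  then show ?thesis
    by (simp add: carrier_alg_Aut alg_hom_star o_bij)
qed

text \<open>The value of \<open>star \<phi>\<close> at \<open>lgen i\<close> recovers
  \<open>\<phi> (var i)\<close>, since \<open>incl\<close> is injective, and these values determine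
  \<open>\<phi>\<close>.\<close>

lemma inj_on_star:
  "inj_on star (carrier (AutL :: (('k::field, 'n::finite) mpol \<Rightarrow> ('k, 'n) mpol) monoid))"
proof (rule inj_onI)
  fix \<phi> \<chi> :: "('k, 'n) mpol \<Rightarrow> ('k, 'n) mpol"
  assume *: "\<phi> \<in> carrier AutL" "\<chi> \<in> carrier AutL" "star \<phi> = star \<chi>"
  have "\<phi> (var i) = \<chi> (var i)" for i
    using *(3) star_lgen[of \<phi> i] star_lgen[of \<chi> i] by (simp add: inj_eq[OF inj_incl])
  with * show "\<phi> = \<chi>"
    by (intro alg_hom_mpol_eqI[of scaleP]) (simp_all add: carrier_alg_Aut)
qed

theorem proposition1:
  shows "(\<forall>\<phi> \<in> carrier (AutL :: (('k::field_char_0, 'n::finite) mpol \<Rightarrow> ('k, 'n) mpol) monoid).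
            (\<exists>!\<psi>. is_star \<phi> \<psi>) \<and> is_star \<phi> (star \<phi>) \<and> star \<phi> \<in> carrier AutU)
       \<and> group_hom (AutL :: (('k, 'n) mpol \<Rightarrow> ('k, 'n) mpol) monoid) AutU star
       \<and> inj_on star (carrier (AutL :: (('k, 'n) mpol \<Rightarrow> ('k, 'n) mpol) monoid))"
proof -
  have "group_hom (AutL :: (('k, 'n) mpol \<Rightarrow> ('k, 'n) mpol) monoid) AutU star"
    by (intro group_hom.intro group_hom_axioms.intro group_alg_Aut vector_space_scaleP
        vector_space_scaleU homI)
      (simp_all add: star_in_AutU, simp add: carrier_alg_Aut mult_alg_Aut star_comp)
  then show ?thesis
    using ex1_is_star is_star_star star_in_AutU inj_on_star by blast
qed

end
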